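(* Let $u\colon\mathcal X\to\mathbb R$ and $x\in\mathcal X\setminus\mathcal O$. Let $\mathcal L$ be the normalized graph Laplacian on $\mathcal G$. Then $$\mathcal L[u](x)=\frac2n\sum_{i=1}^{n/2}\lambda_i[u](x).$$
   Context: $\mathcal G=(\mathcal X,E)$ is a finite simple undirected graph, $\mathcal O\subseteq\mathcal X$ is the set of boundary vertices, and $\mathcal N_x$ is the set of neighbors of $x$. There is a fixed even integer $n\ge2$ with $|\mathcal N_x|=n$ for every $x\in\mathcal X\setminus\mathcal O$ (no degree condition on vertices of $\mathcal O$). For $u\colon\mathcal X\to\mathbb R$, $x\in\mathcal X\setminus\mathcal O$ and $i\in\{1,\dots,n/2\}$, define $$\lambda_i[u](x)=\min_{\substack{S\subseteq\mathcal N_x\\ |S|=2i}}\Bigl(\max_{\substack{y,z\in S\\ y\ne z}}\frac{u(y)+u(z)}2-u(x)\Bigr).$$ The normalized graph Laplacian is, with this sign convention, $\mathcal L[u](x)=\frac1n\sum_{y\in\mathcal N_x}u(y)-u(x)$. *)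

theory Defs
  imports Complex_Main "Graph_Theory.Digraph"
begin

text \<open>
  Simple undirected graphs are the \<open>graph\<close> locale of Graph_Theory: a finite, loop-free
  symmetric digraph without parallel arcs, in which an undirected edge is a pair of opposite arcs.
\<close>

definition neighbors :: "('a, 'b) pre_digraph \<Rightarrow> 'a \<Rightarrow> 'a set" where
  "neighbors G x = {y \<in> verts G. x \<rightarrow>\<^bsub>G\<^esub> y}"

text \<open>
  \<open>Min\<close> and \<open>Max\<close> are meaningful only for finite nonempty sets. This is the case
  here if the neighborhood of \<open>x\<close> is finite and \<open>1 \<le> i\<close>, \<open>2 * i \<le> card (neighbors G x)\<close>.
\<close>

definition graph_eigenvalue ::
    "('a, 'b) pre_digraph \<Rightarrow> nat \<Rightarrow> ('a \<Rightarrow> real) \<Rightarrow> 'a \<Rightarrow> real" where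
  "graph_eigenvalue G i u x =
    Min {Max {(u y + u z) / 2 | y z. y \<in> S \<and> z \<in> S \<and> y \<noteq> z} - u x | S.
           S \<subseteq> neighbors G x \<and> card S = 2 * i}"

text \<open>
  The parameter \<open>n\<close> is the common degree of the interior vertices; the sign is that of the
  Laplace operator (average over the neighbors minus the value at \<open>x\<close>).
\<close>

definition normalized_laplacian ::
    "('a, 'b) pre_digraph \<Rightarrow> nat \<Rightarrow> ('a \<Rightarrow> real) \<Rightarrow> 'a \<Rightarrow> real" where
  "normalized_laplacian G n u x = 1 / real n * (\<Sum>y\<in>neighbors G x. u y) - u x"

end

theory Submission
  imports Defs
begin

text \<open>
  Order the neighbors of \<open>x\<close> so that \<open>u\<close> is nondecreasing, with values
  \<open>u\<^sub>1 \<le> \<dots> \<le> u\<^sub>n\<close>. The largest pair average over a set of \<open>2 i\<close> neighbors is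
  half the sum of its two largest values, and it is smallest for the first \<open>2 i\<close> neighbors. Hence
  the \<open>i\<close>-th eigenvalue is \<open>(u\<^bsub>2i-1\<^esub> + u\<^bsub>2i\<^esub>) / 2 - u x\<close>, and the sum over \<open>i\<close> pairs up
  all the neighbors.
\<close>

text \<open>Pigeonhole: the first \<open>k\<close> entries cover at most \<open>k\<close> elements,
  so a larger set must contain an entry at some later index.\<close>

lemma exists_nth_beyond:
  assumes "S \<subseteq> set xs" and "card S > k"
  obtains j where "k \<le> j" "j < length xs" "xs ! j \<in> S"
proof -
  have "card (set (take k xs)) \<le> k"
    by (metis card_length length_take min.bounded_iff)
  then have "\<not> S \<subseteq> set (take k xs)"
    using assms(2) card_mono[of "set (take k xs)" S] by fastforce
  then obtain y where y: "y \<in> S" "y \<notin> set (take k xs)"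
    by blast
  then obtain j where j: "j < length xs" "xs ! j = y"
    using assms(1) by (metis in_set_conv_nth subsetD)
  have "k \<le> j"
    using j y(2) by (metis in_set_conv_nth length_take min_less_iff_conj not_le nth_take)
  with j y(1) that show thesis
    by blast
qed

lemma finite_pair_averages:
  fixes u :: "'a \<Rightarrow> real"
  assumes "finite S"
  shows "finite {(u y + u z) / 2 | y z. y \<in> S \<and> z \<in> S \<and> y \<noteq> z}"
proof (rule finite_subset)
  show "finite ((\<lambda>(y, z). (u y + u z) / 2) ` (S \<times> S))"
    using assms by simp
qed force

lemma Max_pair_average_ge:
  fixes u :: "'a \<Rightarrow> real"
  assumes "sorted (map u xs)" and "S \<subseteq> set xs" and "card S = k + 2"
  shows "(u (xs ! k) + u (xs ! (k + 1))) / 2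
    \<le> Max {(u y + u z) / 2 | y z. y \<in> S \<and> z \<in> S \<and> y \<noteq> z}"
proof -
  have "finite S"
    using assms(2) finite_subset by blast
  obtain j where j: "k + 1 \<le> j" "j < length xs" "xs ! j \<in> S"
    using exists_nth_beyond[OF assms(2), of "k + 1"] assms(3) by auto
  \<comment> \<open>Deleting \<open>xs ! j\<close> before the second pigeonhole makes the two
    elements distinct, so their average is one of those under the \<open>Max\<close>.\<close>
  have "card (S - {xs ! j}) > k"
    using assms(3) j(3) by simp
  then obtain l where l: "k \<le> l" "l < length xs" "xs ! l \<in> S - {xs ! j}"
    using exists_nth_beyond[of "S - {xs ! j}" xs k] assms(2) by blast
  have "u (xs ! (k + 1)) \<le> u (xs ! j)" "u (xs ! k) \<le> u (xs ! l)"
    using sorted_nth_mono[OF assms(1)] j l by fastforce+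
  then have "(u (xs ! k) + u (xs ! (k + 1))) / 2 \<le> (u (xs ! l) + u (xs ! j)) / 2"
    by simp
  also have "\<dots> \<le> Max {(u y + u z) / 2 | y z. y \<in> S \<and> z \<in> S \<and> y \<noteq> z}"
    by (rule Max_ge[OF finite_pair_averages[OF \<open>finite S\<close>]]) (use j l in blast)
  finally show ?thesis .
qed

text \<open>The prefix of length \<open>k + 2\<close> attains the lower bound of
  \<open>Max_pair_average_ge\<close>: its two largest values sit at its last two indices,
  \<open>k\<close> and \<open>k + 1\<close>.\<close>

lemma Max_pair_average_take:
  fixes u :: "'a \<Rightarrow> real"
  assumes "distinct xs" and "sorted (map u xs)" and "k + 2 \<le> length xs"
  shows "Max {(u y + u z) / 2 | y z.
      y \<in> set (take (k + 2) xs) \<and> z \<in> set (take (k + 2) xs) \<and> y \<noteq> z}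
    = (u (xs ! k) + u (xs ! (k + 1))) / 2" (is "Max ?A = ?r")
proof (rule Max_eqI)
  show "finite ?A"
    by (rule finite_pair_averages) simp
next
  have nth_in: "xs ! j \<in> set (take (k + 2) xs)" if "j < k + 2" for j
    using that assms(3) by (metis in_set_conv_nth length_take min.absorb2 nth_take)
  have "xs ! k \<noteq> xs ! (k + 1)"
    using assms(1,3) by (simp add: nth_eq_iff_index_eq)
  then show "?r \<in> ?A"
    using nth_in[of k] nth_in[of "k + 1"] by force
next
  fix r assume "r \<in> ?A"
  then obtain y z where r: "r = (u y + u z) / 2" "y \<noteq> z"
    and yz: "y \<in> set (take (k + 2) xs)" "z \<in> set (take (k + 2) xs)"
    by blast
  obtain a where a: "a < k + 2" "y = xs ! a"
    using yz(1) assms(3) by (auto simp: in_set_conv_nth)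
  obtain b where b: "b < k + 2" "z = xs ! b"
    using yz(2) assms(3) by (auto simp: in_set_conv_nth)
  have mono: "u (xs ! i) \<le> u (xs ! j)" if "i \<le> j" "j < k + 2" for i j
    using sorted_nth_mono[OF assms(2), of i j] that assms(3) by simp
  have "a \<noteq> b"
    using r(2) a(2) b(2) by blast
  \<comment> \<open>Two distinct indices below \<open>k + 2\<close> cannot both be
    \<open>k + 1\<close>, so monotonicity bounds the sum term by term after a possible swap.\<close>
  then consider "a \<le> k" "b \<le> k + 1" | "a \<le> k + 1" "b \<le> k"
    using a(1) b(1) by linarith
  then show "r \<le> ?r"
    using mono[of a k] mono[of b "k + 1"] mono[of a "k + 1"] mono[of b k]
    unfolding r(1) a(2) b(2) by cases auto
qed

lemma Min_Max_pair_average: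
  fixes u :: "'a \<Rightarrow> real"
  assumes "distinct xs" and "sorted (map u xs)" and "k + 2 \<le> length xs"
  shows "Min {Max {(u y + u z) / 2 | y z. y \<in> S \<and> z \<in> S \<and> y \<noteq> z} - c | S.
      S \<subseteq> set xs \<and> card S = k + 2}
    = (u (xs ! k) + u (xs ! (k + 1))) / 2 - c" (is "Min ?A = ?r")
proof (rule Min_eqI)
  show "finite ?A"
    by simp
next
  fix r assume "r \<in> ?A"
  then show "?r \<le> r"
    using Max_pair_average_ge[OF assms(2)] by fastforce
next
  have "set (take (k + 2) xs) \<subseteq> set xs" "card (set (take (k + 2) xs)) = k + 2"
    using assms(1,3) by (auto simp: distinct_card set_take_subset)
  then show "?r \<in> ?A"
    using Max_pair_average_take[OF assms] by (intro CollectI exI[of _ "set (take (k + 2) xs)"]) simp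
qed

text \<open>Indices count from 0, so the \<open>i\<close>-th pair occupies positions
  \<open>2 * i - 2\<close> and \<open>2 * i - 1\<close>; these pairs partition the positions below
  \<open>2 * m\<close>.\<close>

lemma sum_consecutive_pairs:
  fixes f :: "nat \<Rightarrow> 'b :: comm_monoid_add"
  shows "(\<Sum>i = 1..m. f (2 * i - 2) + f (2 * i - 1)) = (\<Sum>j < 2 * m. f j)"
  by (induction m) (simp_all add: add.assoc)

theorem proposition2p3:
  fixes G :: "('a, 'b) pre_digraph"
    and Bd :: "'a set"
    and n :: nat
    and u :: "'a \<Rightarrow> real"
    and x :: 'a
  assumes "graph G"
    and "Bd \<subseteq> verts G"
    and "even n" and "n \<ge> 2"
    and "\<And>v. v \<in> verts G - Bd \<Longrightarrow> card (neighbors G v) = n"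
    and "x \<in> verts G - Bd"
  shows "normalized_laplacian G n u x =
           2 / real n * (\<Sum>i = 1..n div 2. graph_eigenvalue G i u x)"
proof -
  have card: "card (neighbors G x) = n"
    using assms(5,6) by blast
  \<comment> \<open>\<open>card\<close> is 0 on infinite sets, so a positive degree forces
    finiteness.\<close>
  then have "finite (neighbors G x)"
    using assms(4) by (intro card_ge_0_finite) simp
  then obtain ys where ys: "set ys = neighbors G x" "distinct ys"
    using finite_distinct_list by blast
  define xs where "xs = sort_key u ys"
  have xs: "set xs = neighbors G x" "distinct xs" "sorted (map u xs)"
    using ys by (simp_all add: xs_def)
  then have len: "length xs = n"
    using card distinct_card by fastforce
  have eigenvalue: "graph_eigenvalue G i u x
      = (u (xs ! (2 * i - 2)) + u (xs ! (2 * i - 1))) / 2 - u x" if "i \<in> {1..n div 2}" for i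
  proof -
    \<comment> \<open>Truncated subtraction is exact here because \<open>1 \<le> i\<close>; the
      bound \<open>i \<le> n div 2\<close> keeps the pair inside the list.\<close>
    have "2 * i - 2 + 2 = 2 * i" "2 * i - 2 + 1 = 2 * i - 1" "2 * i - 2 + 2 \<le> length xs"
      using that len by auto
    then show ?thesis
      using Min_Max_pair_average[OF xs(2,3), of "2 * i - 2" "u x"]
      unfolding graph_eigenvalue_def xs(1) by simp
  qed
  have "(\<Sum>i = 1..n div 2. graph_eigenvalue G i u x)
      = (\<Sum>i = 1..n div 2. u (xs ! (2 * i - 2)) + u (xs ! (2 * i - 1))) / 2 - real (n div 2) * u x"
    by (simp add: eigenvalue sum_subtractf sum_divide_distrib)
  \<comment> \<open>Evenness of \<open>n\<close> enters here: \<open>2 * (n div 2) = n\<close>, so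
    the pairs exhaust all the neighbors.\<close>
  also have "\<dots> = (\<Sum>j < n. u (xs ! j)) / 2 - real n / 2 * u x"
    using sum_consecutive_pairs[of "\<lambda>j. u (xs ! j)" "n div 2"] assms(3) by (simp add: real_of_nat_div)
  also have "(\<Sum>j < n. u (xs ! j)) = (\<Sum>y\<in>neighbors G x. u y)"
    using sum.reindex_bij_betw[OF bij_betw_nth[OF xs(2) _ xs(1)[symmetric]], of "{..<n}" u] len by simp
  finally show ?thesis
    using assms(4) by (simp add: normalized_laplacian_def field_simps)
qed

end
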